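(* Let $\triangle ABC$ be a triangle in $\mathbb{C}$, put $\rho=e^{\pi i/3}$, and let $\Omega_A=B+\rho(C-B)$ and $\overline{\Omega}_A=B+\bar\rho(C-B)$, so that $\triangle\Omega_ABC$ and $\triangle\overline{\Omega}_ACB$ are equilateral triangles. If we fix the edge $BC$, the rotation $R_\theta$ can be realized by moving the vertex $A$ along a circle of Apollonius with foci $\Omega_A$ and $\overline{\Omega}_A$, whereas the homothety $H_\lambda$ can be realized by moving the vertex $A$ along a circle through $\Omega_A$ and $\overline{\Omega}_A$. (Illustration: $A$ is moved to $A'$ along a circle of Apollonius with foci $\Omega_A,\overline{\Omega}_A$, realizing $R_\theta$, and then $A'$ is moved to $A''$ along a circle through $\Omega_A$ and $\overline{\Omega}_A$, realizing $H_\lambda$, so that $H_\lambda\circ R_\theta$ maps $[\triangle ABC]$ to $[\triangle A''BC]$.)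
   Context: The plane $\mathbb{R}^2$ is identified with $\mathbb{C}$. Vertices of triangles are labeled anti-clockwise. Two triangles are similar if one is mapped to the other by a composition of homothety, rotation and translation, respecting the order of the vertices; $[\triangle ABC]$ denotes the similarity class of $\triangle ABC$ and $\widetilde{\mathcal{S}}$ the set of similarity classes of triangles. Any triangle $\triangle ABC$ with $|B-C|=a$, $|C-A|=b$, $|A-B|=c$ is denoted by $\triangle(a,b,c)$. Let $\mathcal{D}=\{z\in\mathbb{C}:|z|<1\}$, $A_0=i$, $B_0=-e^{\pi i/6}$, $C_0=e^{-\pi i/6}$, and let $\phi_P:\widetilde{\mathcal{S}}\to\mathcal{D}$ be the bijection with $\phi_P^{-1}(P)=[\triangle(|P-A_0|,|P-B_0|,|P-C_0|)]$ for $P\in\mathcal{D}$. The operations $R_\theta$ and $H_\lambda$ on $\widetilde{\mathcal{S}}$ are those that correspond, through $\phi_P$, to the rotation by $\theta$ and the homothety by $e^\lambda$ (about the origin) in $\mathcal{D}$; that is, $R_\theta(s)=\phi_P^{-1}(e^{i\theta}\phi_P(s))$ and $H_\lambda(s)=\phi_P^{-1}(e^{\lambda}\phi_P(s))$, the latter making sense when $e^\lambda|\phi_P(s)|<1$. Moving the vertex $A$ to a new position $A'$ with $B,C$ fixed realizes an operation when that operation maps $[\triangle ABC]$ to $[\triangle A'BC]$. A circle of Apollonius with foci $\Omega$ and $\overline{\Omega}$ is the set of points $X$ for which the ratio $|X-\Omega|:|X-\overline{\Omega}|$ is a given constant; it may be the perpendicular bisector of $\Omega\overline{\Omega}$ as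 a special case. A line is considered as a circle passing through $\infty$. *)

theory Defs
  imports "HOL-Analysis.Analysis"
begin

text \<open>A triangle is a triple of points of the plane, non-degenerate and labelled anti-clockwise.\<close>

type_synonym triple = "complex \<times> complex \<times> complex"

definition triangles :: "triple set" where
  "triangles = {(A, B, C). Im (cnj (B - A) * (C - A)) > 0}"

definition similarity :: "(triple \<times> triple) set" where
  "similarity = {((A, B, C), (A', B', C')).
     (A, B, C) \<in> triangles \<and> (A', B', C') \<in> triangles \<and>
     (\<exists>k t v. k > 0 \<and>
        (let f = (\<lambda>X. complex_of_real k * cis t * X + v) in
           A' = f A \<and> B' = f B \<and> C' = f C))}"

definition sim_classes :: "triple set set" where
  "sim_classes = triangles // similarity"

definition sim_class :: "complex \<Rightarrow> complex \<Rightarrow> complex \<Rightarrow> triple set" where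
  "sim_class A B C = similarity `` {(A, B, C)}"

definition triangle_of_sides :: "real \<Rightarrow> real \<Rightarrow> real \<Rightarrow> triple" where
  "triangle_of_sides a b c =
     (SOME (A, B, C). (A, B, C) \<in> triangles \<and>
        cmod (B - C) = a \<and> cmod (C - A) = b \<and> cmod (A - B) = c)"

definition A0 :: complex where "A0 = \<i>"
definition B0 :: complex where "B0 = - cis (pi / 6)"
definition C0 :: complex where "C0 = cis (- pi / 6)"

definition unit_disc :: "complex set" where
  "unit_disc = {z. cmod z < 1}"

definition phi_inv :: "complex \<Rightarrow> triple set" where
  "phi_inv P = (case triangle_of_sides (cmod (P - A0)) (cmod (P - B0)) (cmod (P - C0)) of
     (A, B, C) \<Rightarrow> sim_class A B C)"

text \<open>The map \<open>phi_inv\<close> is a bijection from the unit disc onto \<open>sim_classes\<close>: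
  if \<open>A\<close> lies at \<open>z\<close> when \<open>B = 0\<close> and \<open>C = 1\<close>, the point of the disc is \<open>\<i> * cnj w\<close>, where
  \<open>w = (z - cis (pi/3)) / (z - cis (- pi/3))\<close>.\<close>

definition phi :: "triple set \<Rightarrow> complex" where
  "phi = the_inv_into unit_disc phi_inv"

definition rot_op :: "real \<Rightarrow> triple set \<Rightarrow> triple set" where
  "rot_op \<theta> s = phi_inv (cis \<theta> * phi s)"

text \<open>The homothety operation is partial: \<open>hom_op l s\<close> is meaningful only on \<open>hom_dom l\<close>.\<close>

definition hom_dom :: "real \<Rightarrow> triple set set" where
  "hom_dom l = {s \<in> sim_classes. exp l * cmod (phi s) < 1}"

definition hom_op :: "real \<Rightarrow> triple set \<Rightarrow> triple set" where
  "hom_op l s = phi_inv (complex_of_real (exp l) * phi s)"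

definition equilateral :: "complex \<Rightarrow> complex \<Rightarrow> complex \<Rightarrow> bool" where
  "equilateral A B C \<longleftrightarrow>
     (A, B, C) \<in> triangles \<and> dist A B = dist B C \<and> dist B C = dist C A"

text \<open>Lines count as circles (through infinity); only their finite points are recorded.\<close>

definition gen_circle :: "complex set \<Rightarrow> bool" where
  "gen_circle K \<longleftrightarrow>
     (\<exists>c r. r > 0 \<and> K = sphere c r) \<or>
     (\<exists>p d. d \<noteq> 0 \<and> K = range (\<lambda>t. p + complex_of_real t * d))"

text \<open>The ratio \<open>q = 0\<close> gives the point circle \<open>{F}\<close>, needed when the triangle is equilateral;
  \<open>q = 1\<close> gives the perpendicular bisector.  The product form avoids division by zero at \<open>F'\<close>.\<close>

definition apollonius_circle :: "complex \<Rightarrow> complex \<Rightarrow> complex set \<Rightarrow> bool" where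
  "apollonius_circle F F' K \<longleftrightarrow> (\<exists>q\<ge>0. K = {X. dist X F = q * dist X F'})"

text \<open>The vertex \<open>A\<close> moves continuously inside \<open>K\<close> to \<open>A'\<close>, with \<open>B\<close> and \<open>C\<close> fixed and forming
  a triangle with them all the way, and the operation \<open>T\<close> sends the initial class to the final
  one.\<close>

definition realized_along ::
  "(triple set \<Rightarrow> triple set) \<Rightarrow> complex set \<Rightarrow> complex \<Rightarrow> complex \<Rightarrow> complex \<Rightarrow> complex \<Rightarrow> bool" where
  "realized_along T K B C A A' \<longleftrightarrow>
     (\<exists>g. path g \<and> pathstart g = A \<and> pathfinish g = A' \<and>
          path_image g \<subseteq> K \<inter> {X. (X, B, C) \<in> triangles}) \<and>
     T (sim_class A B C) = sim_class A' B C"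

end

theory Submission
  imports Defs
begin

text \<open>Put \<open>w = (A - \<Omega>) / (A - \<Omega>')\<close>, so that \<open>A = (\<Omega> - w \<Omega>') / (1 - w)\<close>.  The
  triangle is anti-clockwise exactly when \<open>w\<close> lies in the unit disc, and comparing side lengths
  shows that the point of the disc attached to the triangle is \<open>\<i> * cnj w\<close>.  Hence the two
  operations multiply \<open>w\<close> by \<open>cis (- \<theta>)\<close> and by \<open>exp l\<close>.  The circles \<open>\<bar>w\<bar> = const\<close> are the circles
  of Apollonius, and the lines through \<open>0\<close> in the \<open>w\<close>-plane are the circles through \<open>\<Omega>\<close>
  (\<open>w = 0\<close>) and \<open>\<Omega>'\<close> (\<open>w = \<infinity>\<close>).\<close>

section \<open>The Moebius coordinate \<open>w\<close> of a vertex\<close>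

definition moebius_point :: "complex \<Rightarrow> complex \<Rightarrow> complex \<Rightarrow> complex" where
  "moebius_point F F' w = (F - w * F') / (1 - w)"

abbreviation (input) \<omega> :: complex where "\<omega> \<equiv> cis (pi / 3)"

lemma omega_eq: "\<omega> = Complex (1/2) (sqrt 3 / 2)"
  by (simp add: complex_eq_iff cos_60 sin_60)

text \<open>For distinct foci the quotient of the two differences is \<open>w\<close>, which makes
  \<open>cmod w\<close> the Apollonius ratio. The excluded value \<open>w = 1\<close> belongs to the
  point at infinity.\<close>

lemma moebius_point_minus:
  assumes "w \<noteq> 1"
  shows "moebius_point F F' w - F = w * (F - F') / (1 - w)"
    and "moebius_point F F' w - F' = (F - F') / (1 - w)"
  using assms by (simp_all add: moebius_point_def field_simps)

lemma moebius_point_affine: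
  assumes "w \<noteq> 1"
  shows "moebius_point (p + a * F) (p + a * F') w = p + a * moebius_point F F' w"
  using assms by (simp add: moebius_point_def field_simps)

lemma moebius_point_inverse:
  assumes "z \<noteq> F'" "F \<noteq> F'"
  shows "moebius_point F F' ((z - F) / (z - F')) = z"
proof -
  have ne: "z - F' \<noteq> 0" "F - F' \<noteq> 0" using assms by simp_all
  have "1 - (z - F) / (z - F') = (F - F') / (z - F')"
    using ne(1) by (simp add: divide_simps)
  moreover have "F - (z - F) / (z - F') * F' = z * (F - F') / (z - F')"
    using ne(1) by (simp add: divide_simps) (simp add: algebra_simps)
  ultimately show ?thesis
    unfolding moebius_point_def using ne by simp
qed

lemma moebius_point_inj:
  assumes "F \<noteq> F'" "w \<noteq> 1" "w' \<noteq> 1" "moebius_point F F' w = moebius_point F F' w'"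
  shows "w = w'"
proof -
  have ne: "F - F' \<noteq> 0" "1 - w \<noteq> 0" "1 - w' \<noteq> 0" using assms by simp_all
  have "(F - F') / (1 - w) = (F - F') / (1 - w')"
    by (simp only: assms(2-4) not_False_eq_True flip: moebius_point_minus(2))
  then have "1 - w = 1 - w'"
    using ne by (metis divide_cancel_left)
  then show ?thesis by simp
qed

text \<open>\<open>cmod w < 1\<close> means that the point is nearer to \<open>\<omega>\<close> than
  to \<open>cnj \<omega>\<close>, that is, above the real axis.\<close>

lemma cmod_less_1_iff_Im_moebius_point:
  assumes "w \<noteq> 1"
  shows "cmod w < 1 \<longleftrightarrow> Im (moebius_point \<omega> (cnj \<omega>) w) > 0"
proof -
  have "cmod (1 - w) > 0" using assms by simp
  have "Im (moebius_point \<omega> (cnj \<omega>) w)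
      = Im ((\<omega> - w * cnj \<omega>) * cnj (1 - w)) / (cmod (1 - w))\<^sup>2"
    unfolding moebius_point_def by (subst complex_div_cnj) simp
  also have "Im ((\<omega> - w * cnj \<omega>) * cnj (1 - w)) = sqrt 3 / 2 * (1 - (cmod w)\<^sup>2)"
    unfolding cmod_power2 by (simp add: omega_eq algebra_simps power2_eq_square)
  finally show ?thesis
    using \<open>cmod (1 - w) > 0\<close> by (simp add: zero_less_divide_iff zero_less_mult_iff
      power_less_one_iff abs_square_less_1)
qed

section \<open>Similarity classes and the ratio \<open>(A - B) / (C - B)\<close>\<close>

lemma triangles_iff:
  "(A, B, C) \<in> triangles \<longleftrightarrow> B \<noteq> C \<and> Im ((A - B) / (C - B)) > 0"
proof (cases "B = C")
  case True
  then show ?thesis by (simp add: triangles_def algebra_simps)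
next
  case False
  have "Im ((A - B) / (C - B)) = Im ((A - B) * cnj (C - B)) / (cmod (C - B))\<^sup>2"
    by (subst complex_div_cnj) simp
  also have "Im ((A - B) * cnj (C - B)) = Im (cnj (B - A) * (C - A))"
    by (simp add: algebra_simps)
  finally show ?thesis
    using False by (simp add: triangles_def zero_less_divide_iff)
qed

text \<open>The ratio is the place of \<open>A\<close> once a similarity has moved \<open>B\<close>
  and \<open>C\<close> to 0 and 1, so it is a complete invariant of a labelled triangle.\<close>

lemma similarity_iff:
  "((A, B, C), (A', B', C')) \<in> similarity \<longleftrightarrow>
     (A, B, C) \<in> triangles \<and> (A', B', C') \<in> triangles \<and>
     (A - B) / (C - B) = (A' - B') / (C' - B')" (is "?L \<longleftrightarrow> ?R")
proof
  assume ?L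
  then obtain k t v where k: "k > (0::real)" and tri: "(A, B, C) \<in> triangles" "(A', B', C') \<in> triangles"
    and eq: "A' = of_real k * cis t * A + v" "B' = of_real k * cis t * B + v"
      "C' = of_real k * cis t * C + v"
    by (auto simp: similarity_def Let_def)
  have "A' - B' = (of_real k * cis t) * (A - B)" "C' - B' = (of_real k * cis t) * (C - B)"
    by (simp_all add: eq algebra_simps)
  with k tri show ?R by simp
next
  assume R: ?R
  then have ne: "B \<noteq> C" "B' \<noteq> C'" by (auto simp: triangles_iff)
  \<comment> \<open>The images of \<open>B\<close> and \<open>C\<close> force the linear
    coefficient; its modulus and argument supply \<open>k\<close> and \<open>t\<close>.\<close>
  define m where "m = (C' - B') / (C - B)"
  have m: "m * (C - B) = C' - B'" "m \<noteq> 0" using ne by (auto simp: m_def)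
  have "A' - B' = m * (A - B)"
    using R ne by (simp add: m_def field_simps)
  define v where "v = B' - m * B"
  have v: "A' = m * A + v" "B' = m * B + v" "C' = m * C + v"
    using \<open>A' - B' = m * (A - B)\<close> m(1) by (simp_all add: v_def algebra_simps)
  have polar: "of_real (cmod m) * cis (Arg m) = m"
    by (metis rcis_cmod_Arg rcis_def)
  have "\<exists>k t v. k > 0 \<and> A' = complex_of_real k * cis t * A + v \<and>
      B' = complex_of_real k * cis t * B + v \<and> C' = complex_of_real k * cis t * C + v"
    by (rule exI[of _ "cmod m"], rule exI[of _ "Arg m"], rule exI[of _ v])
       (simp only: polar v[symmetric] m(2) zero_less_norm_iff simp_thms not_False_eq_True)
  then show ?L
    using R by (simp add: similarity_def Let_def)
qed

lemma sim_class_eq_iff: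
  assumes "(A, B, C) \<in> triangles" "(A', B', C') \<in> triangles"
  shows "sim_class A B C = sim_class A' B' C' \<longleftrightarrow> (A - B) / (C - B) = (A' - B') / (C' - B')"
proof -
  have mem: "(P, Q, R) \<in> sim_class X Y Z \<longleftrightarrow>
      (P, Q, R) \<in> triangles \<and> (X - Y) / (Z - Y) = (P - Q) / (R - Q)"
    if "(X, Y, Z) \<in> triangles" for X Y Z P Q R
    using that by (auto simp: sim_class_def similarity_iff)
  show ?thesis
  proof
    assume "sim_class A B C = sim_class A' B' C'"
    then have "(A', B', C') \<in> sim_class A B C"
      using assms by (simp add: mem)
    then show "(A - B) / (C - B) = (A' - B') / (C' - B')"
      using assms by (simp add: mem)
  next
    assume "(A - B) / (C - B) = (A' - B') / (C' - B')"
    then show "sim_class A B C = sim_class A' B' C'"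
      using assms by (auto simp: mem)
  qed
qed

text \<open>This is the SSS criterion over the base from 0 to 1: subtracting the squared distances
  fixes the real part, and the half-plane fixes the sign of the imaginary part.\<close>

lemma eq_if_equidistant_upper_half_plane:
  assumes "cmod z = cmod z'" "cmod (z - 1) = cmod (z' - 1)" "Im z > 0" "Im z' > 0"
  shows "z = z'"
proof -
  have 1: "(Re z)\<^sup>2 + (Im z)\<^sup>2 = (Re z')\<^sup>2 + (Im z')\<^sup>2"
    using assms(1) by (simp add: cmod_power2 [symmetric])
  have 2: "(Re z - 1)\<^sup>2 + (Im z)\<^sup>2 = (Re z' - 1)\<^sup>2 + (Im z')\<^sup>2"
    using arg_cong[OF assms(2), of "\<lambda>x. x\<^sup>2"] unfolding cmod_power2 by simp
  have re: "Re z = Re z'" using 1 2 by (simp add: power2_eq_square algebra_simps)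
  with 1 have "(Im z)\<^sup>2 = (Im z')\<^sup>2" by simp
  then have "Im z = Im z'" using assms(3,4) by (simp add: power2_eq_iff)
  with re show ?thesis by (simp add: complex_eq_iff)
qed

text \<open>The factor \<open>k\<close> is there because the distances from a disc point to
  \<open>A0\<close>, \<open>B0\<close>, \<open>C0\<close> are only proportional to the sides of the
  triangle at hand. Whatever triple \<open>SOME\<close> picks, its sides determine its ratio and
  hence its class.\<close>

lemma sim_class_triangle_of_sides:
  assumes tri: "(A, B, C) \<in> triangles" and k: "k > 0"
  shows "(case triangle_of_sides (k * cmod (B - C)) (k * cmod (C - A)) (k * cmod (A - B)) of
     (X, Y, Z) \<Rightarrow> sim_class X Y Z) = sim_class A B C"
proof -
  define P where "P = (\<lambda>(X, Y, Z). (X, Y, Z) \<in> triangles \<and> cmod (Y - Z) = k * cmod (B - C) \<and>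
    cmod (Z - X) = k * cmod (C - A) \<and> cmod (X - Y) = k * cmod (A - B))"
  have BC: "B \<noteq> C" "Im ((A - B) / (C - B)) > 0" using tri by (auto simp: triangles_iff)
  have scale: "cmod (of_real k * x - of_real k * y) = k * cmod (x - y)" for x y
    using k by (metis right_diff_distrib norm_mult norm_of_real abs_of_pos)
  \<comment> \<open>The scaled triangle shows that the choice is made from a nonempty set.\<close>
  have "P (of_real k * A, of_real k * B, of_real k * C)"
    using tri k by (simp add: P_def triangles_iff scale) (simp flip: right_diff_distrib)
  then have "P (Eps P)" by (rule someI)
  moreover obtain X Y Z where XYZ: "Eps P = (X, Y, Z)" by (cases "Eps P")
  ultimately have X: "(X, Y, Z) \<in> triangles" "cmod (Y - Z) = k * cmod (B - C)"
    "cmod (Z - X) = k * cmod (C - A)" "cmod (X - Y) = k * cmod (A - B)"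
    by (auto simp: P_def)
  have YZ: "Y \<noteq> Z" "Im ((X - Y) / (Z - Y)) > 0" using X(1) by (auto simp: triangles_iff)
  have "(X - Y) / (Z - Y) = (A - B) / (C - B)"
  proof (rule eq_if_equidistant_upper_half_plane)
    show "cmod ((X - Y) / (Z - Y)) = cmod ((A - B) / (C - B))"
      using X k by (simp add: norm_divide norm_minus_commute[of Z] norm_minus_commute[of C])
    have "(X - Y) / (Z - Y) - 1 = (X - Z) / (Z - Y)" "(A - B) / (C - B) - 1 = (A - C) / (C - B)"
      using YZ BC by (simp_all add: field_simps)
    then show "cmod ((X - Y) / (Z - Y) - 1) = cmod ((A - B) / (C - B) - 1)"
      using X k by (simp add: norm_divide norm_minus_commute[of _ Y] norm_minus_commute[of _ B]
        norm_minus_commute[of Z] norm_minus_commute[of C])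
  qed (use YZ BC in auto)
  then have "sim_class X Y Z = sim_class A B C"
    using X(1) tri by (simp add: sim_class_eq_iff)
  moreover have "triangle_of_sides (k * cmod (B - C)) (k * cmod (C - A)) (k * cmod (A - B)) = (X, Y, Z)"
    using XYZ by (simp add: triangle_of_sides_def P_def)
  ultimately show ?thesis by simp
qed

section \<open>The disc point of a triangle with base from 0 to 1\<close>

lemma omega_neq: "\<omega> \<noteq> cnj \<omega>"
  by (simp add: omega_eq complex_eq_iff)

text \<open>The distances from \<open>\<i> * cnj w\<close> to \<open>A0\<close>, \<open>B0\<close>,
  \<open>C0\<close> are the three sides times one common factor, the modulus of the denominator
  \<open>1 - w\<close> of \<open>moebius_point\<close>.\<close>

lemma phi_inv_moebius:
  assumes w: "cmod w < 1"
  shows "phi_inv (\<i> * cnj w) = sim_class (moebius_point \<omega> (cnj \<omega>) w) 0 1"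
proof -
  have w1: "w \<noteq> 1" using w by auto
  define z where "z = moebius_point \<omega> (cnj \<omega>) w"
  define k where "k = cmod (1 - w)"
  have tri: "(z, 0, 1) \<in> triangles"
    using cmod_less_1_iff_Im_moebius_point[OF w1] w by (simp add: z_def triangles_iff)
  have z: "z * (1 - w) = \<omega> - w * cnj \<omega>"
    using w1 by (simp add: z_def moebius_point_def)
  have k: "k > 0" using w1 by (simp add: k_def)
  \<comment> \<open>The map \<open>v \<mapsto> \<i> * cnj v\<close> is an isometric involution. It
    carries \<open>A0\<close>, \<open>B0\<close>, \<open>C0\<close> to \<open>1\<close>,
    \<open>- \<omega>\<close>, \<open>- cnj \<omega>\<close>, so distances can be measured from
    \<open>w\<close> instead.\<close>
  have rot: "cmod (\<i> * cnj w - v) = cmod (w - \<i> * cnj v)" for v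
  proof -
    have "\<i> * cnj w - v = \<i> * cnj (w - \<i> * cnj v)" by (simp add: algebra_simps)
    then show ?thesis by (metis complex_mod_cnj mult_1 norm_ii norm_mult)
  qed
  have 0: "cmod (\<i> * cnj w - A0) = k * cmod (0 - 1 :: complex)"
    by (subst rot) (simp add: A0_def k_def norm_minus_commute)
  have omega_sq: "\<omega>\<^sup>2 = \<omega> - 1" and omega_cnj: "cnj \<omega> = 1 - \<omega>"
    by (simp_all add: omega_eq complex_eq_iff power2_eq_square)
  \<comment> \<open>Because \<open>\<omega>\<close> is a root of \<open>x\<^sup>2 = x - 1\<close>,
    multiplying \<open>1 - z\<close> and then \<open>z\<close> by \<open>1 - w\<close> gives unit
    multiples of \<open>w + \<omega>\<close> and \<open>w + cnj \<omega>\<close>.\<close>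
  have "(1 - z) * (1 - w) = (1 - w) - z * (1 - w)"
    by (simp add: algebra_simps)
  also have "\<dots> = - (\<omega> * (w + \<omega>))"
    unfolding z omega_cnj using omega_sq by (simp add: algebra_simps power2_eq_square)
  finally have "cmod (1 - z) * cmod (1 - w) = cmod (w + \<omega>)"
    by (simp flip: norm_mult add: norm_mult[of \<omega>])
  then have 1: "cmod (w + \<omega>) = k * cmod (1 - z)"
    by (simp add: k_def mult.commute)
  have "z * (1 - w) = \<omega>\<^sup>2 * w + \<omega> * 1"
    unfolding z omega_cnj omega_sq by (simp add: algebra_simps)
  also have "\<omega> * 1 = \<omega>\<^sup>2 * cnj \<omega>"
    by (simp add: power2_eq_square cis_cnj cis_mult)
  finally have "z * (1 - w) = \<omega>\<^sup>2 * (w + cnj \<omega>)"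
    by (simp add: algebra_simps)
  then have "cmod z * cmod (1 - w) = cmod (w + cnj \<omega>)"
    by (simp flip: norm_mult add: norm_mult[of "\<omega>\<^sup>2"] norm_power)
  then have 2: "cmod (w + cnj \<omega>) = k * cmod (z - 0)"
    by (simp add: k_def mult.commute)
  have "\<i> * cnj B0 = - \<omega>" "\<i> * cnj C0 = - cnj \<omega>"
    by (simp_all add: B0_def C0_def omega_eq complex_eq_iff cos_30 sin_30)
  then have "cmod (\<i> * cnj w - B0) = k * cmod (1 - z)" "cmod (\<i> * cnj w - C0) = k * cmod (z - 0)"
    using 1 2 by (simp_all only: rot diff_minus_eq_add)
  then show ?thesis
    unfolding phi_inv_def 0 z_def[symmetric] using sim_class_triangle_of_sides[OF tri k] by simp
qed

section \<open>Circles through both foci as images of lines through 0\<close>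

lemma gen_circle_through_moebius_line:
  assumes "F \<noteq> F'" "u \<noteq> 0"
  shows "\<exists>K. gen_circle K \<and> F \<in> K \<and> F' \<in> K \<and>
    (\<forall>s. of_real s * u \<noteq> 1 \<longrightarrow> moebius_point F F' (of_real s * u) \<in> K)"
proof -
  \<comment> \<open>In the frame with origin at the midpoint of the foci and unit \<open>d\<close>,
    the foci are 1 and -1 and the moving point is the Cayley transform
    \<open>(1 + w) / (1 - w)\<close>.\<close>
  define m d where "m = (F + F') / 2" and "d = (F - F') / 2"
  have d: "d \<noteq> 0" using assms by (simp add: d_def)
  have F: "F = m + d" "F' = m - d" by (simp_all add: m_def d_def field_simps)
  have mp: "moebius_point F F' w = m + d * ((1 + w) / (1 - w))" if "w \<noteq> 1" for w
    using that by (simp add: moebius_point_def F field_simps)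
  show ?thesis
  proof (cases "Im u = 0")
    case True
    then have u: "u = of_real (Re u)" by (simp add: complex_eq_iff)
    \<comment> \<open>For real \<open>u\<close> the Cayley transform is real, so the point stays on
      the line through the foci.\<close>
    let ?K = "range (\<lambda>t. m + complex_of_real t * d)"
    have "gen_circle ?K" using d unfolding gen_circle_def by blast
    moreover have "F \<in> ?K" by (auto simp: F intro!: image_eqI[of _ _ 1])
    moreover have "F' \<in> ?K" by (auto simp: F intro!: image_eqI[of _ _ "-1"])
    moreover have "moebius_point F F' (of_real s * u) \<in> ?K" if "of_real s * u \<noteq> 1" for s
    proof (rule image_eqI)
      show "moebius_point F F' (of_real s * u) =
          m + of_real ((1 + s * Re u) / (1 - s * Re u)) * d"
        unfolding mp[OF that] by (subst (1 2) u) simp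
    qed simp
    ultimately show ?thesis by blast
  next
    case False
    \<comment> \<open>\<open>k\<close> is the cotangent of the argument of \<open>u\<close>. The
      centre \<open>?c\<close> lies on the perpendicular bisector of the foci, and \<open>?r\<close>
      is its distance to either focus.\<close>
    define k where "k = Re u / Im u"
    let ?c = "m + \<i> * of_real k * d" and ?r = "cmod (1 - \<i> * of_real k) * cmod d"
    have pos: "?r > 0" using d by (simp add: complex_eq_iff)
    have conj: "cmod (1 + \<i> * of_real k) = cmod (1 - \<i> * of_real k)"
      by (simp add: cmod_def)
    have "moebius_point F F' w \<in> sphere ?c ?r" if w: "w = of_real s * u" "w \<noteq> 1" for w s
    proof -
      \<comment> \<open>As \<open>w\<close> is a real multiple of \<open>of_real k + \<i>\<close>,
        the number under the first norm below equals
        \<open>(1 - \<i> * of_real k) * (1 - cnj w)\<close>, and conjugating the last factor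
        preserves the modulus.\<close>
      have "Re w = k * Im w" using False by (simp add: w k_def)
      then have "(cmod (1 + w - \<i> * of_real k * (1 - w)))\<^sup>2
          = (cmod ((1 - \<i> * of_real k) * (1 - w)))\<^sup>2"
        unfolding cmod_power2 by (simp add: power2_eq_square algebra_simps)
      then have eq: "cmod (1 + w - \<i> * of_real k * (1 - w))
          = cmod (1 - \<i> * of_real k) * cmod (1 - w)"
        by (simp add: norm_mult)
      have "moebius_point F F' w - ?c = d * (1 + w - \<i> * of_real k * (1 - w)) / (1 - w)"
        using w(2) by (simp add: mp field_simps)
      then show ?thesis
        using w(2) eq by (simp add: dist_norm norm_minus_commute[of ?c] norm_mult norm_divide)
    qed
    moreover have "gen_circle (sphere ?c ?r)" using pos by (auto simp: gen_circle_def)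
    moreover have "F \<in> sphere ?c ?r"
    proof -
      have "F - ?c = d * (1 - \<i> * of_real k)" by (simp add: F algebra_simps)
      then show ?thesis by (simp add: dist_norm norm_minus_commute[of ?c] norm_mult)
    qed
    moreover have "F' \<in> sphere ?c ?r"
    proof -
      have "?c - F' = d * (1 + \<i> * of_real k)" by (simp add: F algebra_simps)
      then show ?thesis by (simp add: dist_norm norm_mult conj)
    qed
    ultimately show ?thesis by blast
  qed
qed

section \<open>Transfer to an arbitrary edge \<open>B\<close>, \<open>C\<close>\<close>

context
  fixes B C \<Omega> \<Omega>' :: complex
  assumes BC: "B \<noteq> C"
    and Omega: "\<Omega> = B + \<omega> * (C - B)" "\<Omega>' = B + cnj \<omega> * (C - B)"
begin

lemma Omega_neq: "\<Omega> \<noteq> \<Omega>'"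
  using BC omega_neq by (simp add: Omega)

text \<open>The map \<open>X \<mapsto> B + (C - B) * X\<close> sends 0, 1, \<open>\<omega>\<close>,
  \<open>cnj \<omega>\<close> to \<open>B\<close>, \<open>C\<close>, \<open>\<Omega>\<close>,
  \<open>\<Omega>'\<close>, and the coordinate \<open>w\<close> is invariant under it.\<close>

lemma moebius_point_Omega:
  assumes "w \<noteq> 1"
  shows "moebius_point \<Omega> \<Omega>' w = B + (C - B) * moebius_point \<omega> (cnj \<omega>) w"
  using moebius_point_affine[OF assms, of B "C - B" \<omega> "cnj \<omega>"] by (simp add: Omega mult.commute)

lemma moebius_point_in_triangles_iff:
  assumes "w \<noteq> 1"
  shows "(moebius_point \<Omega> \<Omega>' w, B, C) \<in> triangles \<longleftrightarrow> cmod w < 1"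
  using BC assms by (simp add: triangles_iff moebius_point_Omega cmod_less_1_iff_Im_moebius_point)

lemma triangle_moebius_pointE:
  assumes "(A, B, C) \<in> triangles"
  obtains w where "cmod w < 1" "A = moebius_point \<Omega> \<Omega>' w"
proof -
  define w where "w = (A - \<Omega>) / (A - \<Omega>')"
  \<comment> \<open>\<open>\<Omega>'\<close> lies on the clockwise side of the edge, so
    \<open>A\<close> differs from it and the denominator of \<open>w\<close> is nonzero.\<close>
  have "(\<Omega>', B, C) \<notin> triangles"
    using BC by (simp add: triangles_iff Omega omega_eq)
  then have ne: "A \<noteq> \<Omega>'" using assms by auto
  then have A: "A = moebius_point \<Omega> \<Omega>' w"
    using Omega_neq by (simp add: w_def moebius_point_inverse)
  have "w \<noteq> 1" using ne Omega_neq by (simp add: w_def)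
  then have "cmod w < 1" using A assms moebius_point_in_triangles_iff by blast
  with A show thesis using that by blast
qed

lemma phi_inv_eq:
  assumes w: "cmod w < 1"
  shows "phi_inv (\<i> * cnj w) = sim_class (moebius_point \<Omega> \<Omega>' w) B C"
proof -
  have w1: "w \<noteq> 1" using w by auto
  have "(moebius_point \<omega> (cnj \<omega>) w, 0, 1) \<in> triangles"
    using w w1 by (simp add: triangles_iff cmod_less_1_iff_Im_moebius_point)
  then have "sim_class (moebius_point \<omega> (cnj \<omega>) w) 0 1 = sim_class (moebius_point \<Omega> \<Omega>' w) B C"
    using w w1 BC moebius_point_in_triangles_iff
    by (subst sim_class_eq_iff) (auto simp: moebius_point_Omega)
  then show ?thesis using w by (simp add: phi_inv_moebius)
qed

text \<open>The value of \<open>the_inv_into\<close> rests on injectivity of \<open>phi_inv\<close>: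
  two classes written with the common edge \<open>B\<close>, \<open>C\<close> agree only if their
  third vertices, hence their coordinates, agree.\<close>

lemma phi_eq:
  assumes w: "cmod w < 1"
  shows "phi (sim_class (moebius_point \<Omega> \<Omega>' w) B C) = \<i> * cnj w"
  unfolding phi_def
proof (rule the_inv_into_f_eq)
  show "inj_on phi_inv unit_disc"
  proof (rule inj_onI)
    fix P Q assume P: "P \<in> unit_disc" and Q: "Q \<in> unit_disc" and eq: "phi_inv P = phi_inv Q"
    \<comment> \<open>Since \<open>v \<mapsto> \<i> * cnj v\<close> is its own inverse, every disc
      point has the form treated by \<open>phi_inv_eq\<close>.\<close>
    define p q where "p = \<i> * cnj P" and "q = \<i> * cnj Q"
    have PQ: "P = \<i> * cnj p" "Q = \<i> * cnj q" by (simp_all add: p_def q_def)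
    have pq: "cmod p < 1" "cmod q < 1" using P Q by (simp_all add: PQ unit_disc_def norm_mult)
    then have pq1: "p \<noteq> 1" "q \<noteq> 1" by auto
    have "sim_class (moebius_point \<Omega> \<Omega>' p) B C = sim_class (moebius_point \<Omega> \<Omega>' q) B C"
      using eq pq by (simp add: PQ phi_inv_eq)
    then have "moebius_point \<Omega> \<Omega>' p = moebius_point \<Omega> \<Omega>' q"
      using pq pq1 BC moebius_point_in_triangles_iff by (subst (asm) sim_class_eq_iff) auto
    then show "P = Q" using moebius_point_inj Omega_neq pq1 PQ by metis
  qed
qed (use w in \<open>simp_all add: phi_inv_eq unit_disc_def norm_mult\<close>)

text \<open>The conjugation in \<open>\<i> * cnj w\<close> reverses the sense of rotation, whence
  the minus sign.\<close>

lemma rot_op_eq: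
  assumes w: "cmod w < 1"
  shows "rot_op \<theta> (sim_class (moebius_point \<Omega> \<Omega>' w) B C) =
    sim_class (moebius_point \<Omega> \<Omega>' (cis (- \<theta>) * w)) B C"
proof -
  have "cis \<theta> * (\<i> * cnj w) = \<i> * cnj (cis (- \<theta>) * w)" by (simp add: cis_cnj)
  moreover have "cmod (cis (- \<theta>) * w) < 1" using w by (simp add: norm_mult)
  ultimately show ?thesis using w by (simp only: rot_op_def phi_eq phi_inv_eq)
qed

lemma hom_op_eq:
  assumes w: "cmod w < 1" "cmod (of_real (exp l) * w) < 1"
  shows "hom_op l (sim_class (moebius_point \<Omega> \<Omega>' w) B C) =
    sim_class (moebius_point \<Omega> \<Omega>' (of_real (exp l) * w)) B C"
proof -
  have "of_real (exp l) * (\<i> * cnj w) = \<i> * cnj (of_real (exp l) * w)" by simp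
  then show ?thesis using w by (simp only: hom_op_def phi_eq phi_inv_eq)
qed

section \<open>Realizing the operations by paths in the \<open>w\<close>-disc\<close>

lemma realized_along_moebius_path:
  assumes h: "path h" "pathstart h = w" "pathfinish h = w'"
    and disc: "path_image h \<subseteq> ball 0 1"
    and K: "moebius_point \<Omega> \<Omega>' ` path_image h \<subseteq> K"
    and T: "T (sim_class (moebius_point \<Omega> \<Omega>' w) B C) = sim_class (moebius_point \<Omega> \<Omega>' w') B C"
  shows "realized_along T K B C (moebius_point \<Omega> \<Omega>' w) (moebius_point \<Omega> \<Omega>' w')"
proof -
  \<comment> \<open>Staying in the open disc serves twice: it avoids the pole at 1, giving
    continuity, and it keeps the moving triangle anti-clockwise.\<close>
  have ne: "w \<noteq> 1" if "w \<in> path_image h" for w using that disc by auto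
  then have "continuous_on (path_image h) (moebius_point \<Omega> \<Omega>')"
    unfolding moebius_point_def by (intro continuous_intros) auto
  then have "path (moebius_point \<Omega> \<Omega>' \<circ> h)"
    using h(1) by (rule path_continuous_image[rotated])
  moreover have "(moebius_point \<Omega> \<Omega>' v, B, C) \<in> triangles" if "v \<in> path_image h" for v
    using that disc ne moebius_point_in_triangles_iff by (auto simp: subset_iff)
  ultimately show ?thesis
    using K T h unfolding realized_along_def
    by (intro conjI exI[of _ "moebius_point \<Omega> \<Omega>' \<circ> h"])
       (auto simp: path_image_compose pathstart_compose pathfinish_compose)
qed

lemma rot_op_realized:
  assumes w: "cmod w < 1"
  shows "\<exists>K. apollonius_circle \<Omega> \<Omega>' K \<and> (\<forall>\<theta>. realized_along (rot_op \<theta>) K B C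
    (moebius_point \<Omega> \<Omega>' w) (moebius_point \<Omega> \<Omega>' (cis (- \<theta>) * w)))"
proof (intro exI conjI allI)
  let ?K = "{X. dist X \<Omega> = cmod w * dist X \<Omega>'}"
  show "apollonius_circle \<Omega> \<Omega>' ?K"
    unfolding apollonius_circle_def by (intro exI[of _ "cmod w"] conjI) simp_all
  fix \<theta>
  show "realized_along (rot_op \<theta>) ?K B C
    (moebius_point \<Omega> \<Omega>' w) (moebius_point \<Omega> \<Omega>' (cis (- \<theta>) * w))"
  proof (rule realized_along_moebius_path)
    \<comment> \<open>The modulus stays \<open>cmod w\<close> along this arc, so one circle serves
      every angle, full turns included.\<close>
    let ?h = "\<lambda>t. cis (t * (- \<theta>)) * w"
    show "path ?h" by (auto simp: path_def intro!: continuous_intros)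
    show "pathstart ?h = w" "pathfinish ?h = cis (- \<theta>) * w"
      by (simp_all add: pathstart_def pathfinish_def)
    show "path_image ?h \<subseteq> ball 0 1" using w by (auto simp: path_image_def norm_mult)
    have "cis t * w \<noteq> 1" for t using w by (metis norm_cis norm_mult mult_1 norm_one less_irrefl)
    then show "moebius_point \<Omega> \<Omega>' ` path_image ?h \<subseteq> ?K"
      by (auto simp: path_image_def dist_norm moebius_point_minus norm_mult norm_divide)
  qed (simp add: rot_op_eq w)
qed

lemma hom_op_realized:
  assumes w: "cmod w < 1"
  shows "\<exists>K. gen_circle K \<and> \<Omega> \<in> K \<and> \<Omega>' \<in> K \<and>
    (\<forall>l. sim_class (moebius_point \<Omega> \<Omega>' w) B C \<in> hom_dom l \<longrightarrow> realized_along (hom_op l) K B C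
      (moebius_point \<Omega> \<Omega>' w) (moebius_point \<Omega> \<Omega>' (of_real (exp l) * w)))"
proof -
  \<comment> \<open>For the equilateral triangle, \<open>w = 0\<close>, every circle through both foci works.\<close>
  define u where "u = (if w = 0 then 1 else w)"
  then have "u \<noteq> 0" by simp
  obtain K where K: "gen_circle K" "\<Omega> \<in> K" "\<Omega>' \<in> K"
    and on_K: "of_real s * u \<noteq> 1 \<Longrightarrow> moebius_point \<Omega> \<Omega>' (of_real s * u) \<in> K" for s
    using gen_circle_through_moebius_line[of \<Omega> \<Omega>' u] Omega_neq \<open>u \<noteq> 0\<close> by blast
  \<comment> \<open>If \<open>w = 0\<close> the point is the focus \<open>\<Omega>\<close> for every
    \<open>s\<close>, which is the case \<open>s = 0\<close> of \<open>on_K\<close>.\<close>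
  have on_K': "moebius_point \<Omega> \<Omega>' (of_real s * w) \<in> K" if "of_real s * w \<noteq> 1" for s
    using on_K[of s] on_K[of 0] that by (cases "w = 0") (auto simp: u_def)
  have "realized_along (hom_op l) K B C
      (moebius_point \<Omega> \<Omega>' w) (moebius_point \<Omega> \<Omega>' (of_real (exp l) * w))"
    if "sim_class (moebius_point \<Omega> \<Omega>' w) B C \<in> hom_dom l" for l
  proof (rule realized_along_moebius_path)
    \<comment> \<open>As \<open>phi\<close> of the class has modulus \<open>cmod w\<close>,
      membership in \<open>hom_dom\<close> places the far end of the segment in the disc; convexity
      gives the rest.\<close>
    have lw: "cmod (of_real (exp l) * w) < 1"
      using that w by (simp add: hom_dom_def phi_eq norm_mult)
    let ?h = "linepath w (of_real (exp l) * w)"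
    show disc: "path_image ?h \<subseteq> ball 0 1"
      using w lw by (simp only: path_image_linepath) (intro closed_segment_subset, auto)
    show "moebius_point \<Omega> \<Omega>' ` path_image ?h \<subseteq> K"
    proof (rule image_subsetI)
      fix v assume v: "v \<in> path_image ?h"
      \<comment> \<open>Both ends are real multiples of \<open>w\<close>, so the segment lies on the
        line through 0 whose image is in \<open>K\<close>.\<close>
      then obtain t where "v = of_real (1 - t + t * exp l) * w"
        by (auto simp: path_image_def linepath_def algebra_simps scaleR_conv_of_real)
      moreover have "v \<noteq> 1" using v disc by auto
      ultimately show "moebius_point \<Omega> \<Omega>' v \<in> K" using on_K' by blast
    qed
    show "hom_op l (sim_class (moebius_point \<Omega> \<Omega>' w) B C) =
        sim_class (moebius_point \<Omega> \<Omega>' (of_real (exp l) * w)) B C"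
      using w lw by (rule hom_op_eq)
  qed simp_all
  with K show ?thesis by blast
qed

end

section \<open>Equilateral triangles on the edge, and the conclusion\<close>

lemma equilateral_apex:
  assumes "B \<noteq> C"
  shows "equilateral (B + \<omega> * (C - B)) B C"
proof -
  let ?X = "B + \<omega> * (C - B)"
  \<comment> \<open>This is \<open>1 - \<omega> = cnj \<omega>\<close>; both sides at the apex are
    thus unit multiples of the edge.\<close>
  have "C - ?X = cnj \<omega> * (C - B)" by (simp add: omega_eq complex_eq_iff algebra_simps)
  then have "dist C ?X = dist B C"
    by (simp add: dist_norm norm_mult norm_minus_commute[of C B])
  moreover have "dist ?X B = dist B C" by (simp add: dist_norm norm_mult norm_minus_commute)
  ultimately show ?thesis
    using assms by (simp add: equilateral_def triangles_iff omega_eq)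
qed

theorem proposition8:
  fixes A B C \<rho> \<Omega> \<Omega>' :: complex
  assumes "(A, B, C) \<in> triangles"
    and "\<rho> = cis (pi / 3)"
    and "\<Omega> = B + \<rho> * (C - B)"
    and "\<Omega>' = B + cnj \<rho> * (C - B)"
  shows "equilateral \<Omega> B C \<and> equilateral \<Omega>' C B \<and>
    (\<exists>K. apollonius_circle \<Omega> \<Omega>' K \<and>
       (\<forall>\<theta>. \<exists>A'. realized_along (rot_op \<theta>) K B C A A')) \<and>
    (\<exists>K. gen_circle K \<and> \<Omega> \<in> K \<and> \<Omega>' \<in> K \<and>
       (\<forall>l. sim_class A B C \<in> hom_dom l \<longrightarrow>
          (\<exists>A'. realized_along (hom_op l) K B C A A'))) \<and>
    (\<forall>\<theta> l. rot_op \<theta> (sim_class A B C) \<in> hom_dom l \<longrightarrow>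
       (\<exists>K A' K' A''.
          apollonius_circle \<Omega> \<Omega>' K \<and> realized_along (rot_op \<theta>) K B C A A' \<and>
          gen_circle K' \<and> \<Omega> \<in> K' \<and> \<Omega>' \<in> K' \<and> realized_along (hom_op l) K' B C A' A'' \<and>
          (hom_op l \<circ> rot_op \<theta>) (sim_class A B C) = sim_class A'' B C))"
proof -
  have BC: "B \<noteq> C" using assms(1) by (simp add: triangles_iff)
  have Omega: "\<Omega> = B + \<omega> * (C - B)" "\<Omega>' = B + cnj \<omega> * (C - B)" using assms by simp_all
  note rot = rot_op_realized[OF BC Omega] and hom = hom_op_realized[OF BC Omega]
  obtain w where w: "cmod w < 1" "A = moebius_point \<Omega> \<Omega>' w"
    using triangle_moebius_pointE[OF BC Omega assms(1)] .
  \<comment> \<open>Seen from the reversed edge, \<open>\<Omega>'\<close> is the same kind of apex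
    as \<open>\<Omega>\<close>, so \<open>equilateral_apex\<close> covers both.\<close>
  have "\<Omega>' = C + \<omega> * (B - C)"
    by (simp add: Omega omega_eq complex_eq_iff algebra_simps)
  then have "equilateral \<Omega> B C \<and> equilateral \<Omega>' C B"
    using equilateral_apex BC Omega(1) by metis
  moreover have "\<exists>K A' K' A''.
      apollonius_circle \<Omega> \<Omega>' K \<and> realized_along (rot_op \<theta>) K B C A A' \<and>
      gen_circle K' \<and> \<Omega> \<in> K' \<and> \<Omega>' \<in> K' \<and> realized_along (hom_op l) K' B C A' A'' \<and>
      (hom_op l \<circ> rot_op \<theta>) (sim_class A B C) = sim_class A'' B C"
    if dom: "rot_op \<theta> (sim_class A B C) \<in> hom_dom l" for \<theta> l
  proof -
    \<comment> \<open>The rotated coordinate is again in the disc, so the homothety result applies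
      with the new vertex as its starting point.\<close>
    let ?w = "cis (- \<theta>) * w"
    have w': "cmod ?w < 1" using w by (simp add: norm_mult)
    obtain K where K: "apollonius_circle \<Omega> \<Omega>' K"
      "realized_along (rot_op \<theta>) K B C A (moebius_point \<Omega> \<Omega>' ?w)"
      using rot[OF w(1)] w(2) by blast
    then have eq: "rot_op \<theta> (sim_class A B C) = sim_class (moebius_point \<Omega> \<Omega>' ?w) B C"
      by (simp add: realized_along_def)
    obtain K' A'' where K': "gen_circle K'" "\<Omega> \<in> K'" "\<Omega>' \<in> K'"
      "realized_along (hom_op l) K' B C (moebius_point \<Omega> \<Omega>' ?w) A''"
      using hom[OF w'] dom eq by metis
    then have "(hom_op l \<circ> rot_op \<theta>) (sim_class A B C) = sim_class A'' B C"
      by (simp add: eq realized_along_def)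
    with K K' show ?thesis by blast
  qed
  ultimately show ?thesis
    using rot[OF w(1)] hom[OF w(1)] unfolding w(2) by blast
qed

end
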